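(* Let $n$ and $k$ be positive integers. Then $$(n!!)^k+n^k=(k!!)^n+k^n$$ holds if and only if $k=n$.
   Context: For a positive integer $m$, the double factorial $m!!$ is the product of all positive integers $\le m$ having the same parity as $m$, i.e. $m!!=m(m-2)(m-4)\cdots$, ending in $1$ if $m$ is odd and in $2$ if $m$ is even. *)

theory Defs
  imports Complex_Main
begin

definition double_fact :: "nat \<Rightarrow> nat" where
  "double_fact m = \<Prod>{j \<in> {1..m}. even j \<longleftrightarrow> even m}"

lemma double_fact_0: "double_fact 0 = 1"
  by (simp add: double_fact_def)

lemma double_fact_1: "double_fact (Suc 0) = 1"
proof -
  have "{j \<in> {1..Suc 0}. even j \<longleftrightarrow> even (Suc 0)} = {Suc 0}"
    by auto
  then show ?thesis
    by (simp add: double_fact_def)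
qed

lemma double_fact_Suc_Suc:
  "double_fact (Suc (Suc m)) = Suc (Suc m) * double_fact m"
proof -
  have "{j \<in> {1..Suc (Suc m)}. even j \<longleftrightarrow> even (Suc (Suc m))} =
      insert (Suc (Suc m)) {j \<in> {1..m}. even j \<longleftrightarrow> even m}"
    by (auto simp: le_Suc_eq)
  then show ?thesis
    by (simp add: double_fact_def)
qed

end

theory Submission
  imports Defs
begin

text \<open>
  For \<open>n < k\<close> one shows that \<open>n!!^k + n^k \<le> k!!^n\<close>, except for \<open>(n, k) = (2, 3)\<close>. By
  monotonicity of the \<open>\<ell>\<^sup>p\<close> norms, \<open>(a^k + b^k)^(k+1) \<ge> (a^(k+1) + b^(k+1))^k\<close>, and by
  \<open>(k+1)!!^k \<ge> k!!^(k+1)\<close> this inequality passes from \<open>k\<close> to \<open>k + 1\<close>, so that only \<open>k = n + 1\<close>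
  needs work. There it follows from Wallis-type lower bounds on \<open>((n+1)!! / n!!)^2\<close>, proved by
  induction on \<open>n\<close> in steps of two, combined with upper bounds on \<open>n!!\<close>.
\<close>

section \<open>Positivity, small values and recursion\<close>

lemma double_fact_pos: "double_fact n > 0"
  unfolding double_fact_def by (rule prod_pos) auto

lemma double_fact_2: "double_fact 2 = 2"
  using double_fact_Suc_Suc[of 0] by (simp add: double_fact_0 numeral_2_eq_2)

lemma double_fact_3: "double_fact 3 = 3"
  using double_fact_Suc_Suc[of 1] by (simp add: double_fact_1 numeral_3_eq_3)

lemma double_fact_4: "double_fact 4 = 8"
  using double_fact_Suc_Suc[of 2] by (simp add: double_fact_2)

lemma double_fact_add_2: "double_fact (m + 2) = (m + 2) * double_fact m"
  using double_fact_Suc_Suc[of m] by (simp only: add_2_eq_Suc')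

lemma double_fact_even_step: "double_fact (2 * Suc m) = (2 * m + 2) * double_fact (2 * m)"
  using double_fact_add_2[of "2 * m"] by (simp only: mult_Suc_right add.commute)

lemma double_fact_odd_step:
  "double_fact (2 * Suc m + 1) = (2 * m + 3) * double_fact (2 * m + 1)"
proof -
  have "2 * Suc m + 1 = 2 * m + 1 + 2" "2 * m + 3 = 2 * m + 1 + 2" by simp_all
  then show ?thesis by (simp only: double_fact_add_2)
qed

lemma double_fact_even_step':
  "double_fact (2 * Suc m + 2) = (2 * m + 4) * double_fact (2 * m + 2)"
proof -
  have "2 * Suc m + 2 = 2 * m + 2 + 2" "2 * m + 4 = 2 * m + 2 + 2" by simp_all
  then show ?thesis by (simp only: double_fact_add_2)
qed

section \<open>Growth bounds and Wallis-type ratios\<close>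

lemma le_double_fact: "n \<le> double_fact n"
proof (cases "n < 2")
  case True
  then show ?thesis by (auto simp: less_2_cases_iff double_fact_1)
next
  case False
  then obtain m where "n = Suc (Suc m)"
    by (metis One_nat_def Suc_1 not_less_eq old.nat.exhaust zero_less_Suc)
  then show ?thesis using double_fact_pos[of m]
    by (simp add: double_fact_Suc_Suc del: mult_Suc)
qed

text \<open>Equality holds at \<open>m = 2\<close>. The factor 2, raised to the power
  \<open>Suc n\<close>, later makes \<open>n ^ Suc n\<close> small against
  \<open>double_fact n ^ Suc n\<close>.\<close>

lemma double_le_double_fact_even:
  assumes "m \<ge> 2"
  shows "2 * (2 * m) \<le> double_fact (2 * m)"
  using assms
proof (induction m rule: dec_induct)
  case base
  then show ?case by (simp add: double_fact_4)
next
  case (step m)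
  have "2 * (2 * Suc m) \<le> (2 * m + 2) * double_fact (2 * m)"
    using step by simp
  then show ?case by (simp only: double_fact_even_step)
qed

text \<open>Binomial expansion cut after two terms. At \<open>a = m + 1\<close>,
  \<open>k = m\<close> it gives \<open>2 * (m + 1) ^ Suc m \<le> (m + 2) ^ Suc m\<close>.\<close>

lemma bernoulli_nat:
  fixes a :: nat
  shows "a ^ Suc k + Suc k * a ^ k \<le> (a + 1) ^ Suc k"
proof (induction k)
  case 0
  then show ?case by simp
next
  case (Suc k)
  have "a ^ Suc (Suc k) + Suc (Suc k) * a ^ Suc k \<le> (a + 1) * (a ^ Suc k + Suc k * a ^ k)"
    by (simp add: algebra_simps)
  also have "\<dots> \<le> (a + 1) * (a + 1) ^ Suc k"
    using Suc.IH by (rule mult_left_mono) simp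
  finally show ?case by simp
qed

text \<open>AM-GM in substance: the factors 2, 4, ..., 2m have mean m + 1.\<close>

lemma double_fact_even_le: "double_fact (2 * m) \<le> (m + 1) ^ m"
proof (induction m)
  case 0
  then show ?case by (simp add: double_fact_0)
next
  case (Suc m)
  have "double_fact (2 * Suc m) \<le> (2 * m + 2) * (m + 1) ^ m"
    unfolding double_fact_even_step using Suc.IH by (rule mult_left_mono) simp
  also have "\<dots> = (m + 1) ^ Suc m + Suc m * (m + 1) ^ m" by (simp add: algebra_simps)
  also have "\<dots> \<le> (Suc m + 1) ^ Suc m" using bernoulli_nat[of "m + 1" m] by simp
  finally show ?case .
qed

text \<open>Each of the m factors 3, 5, ..., 2m + 1 is below 2m + 3. The base is chosen to match the
  factor in \<open>wallis_even_odd\<close>.\<close>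

lemma double_fact_odd_le: "double_fact (2 * m + 1) \<le> (2 * m + 3) ^ m"
proof (induction m)
  case 0
  then show ?case by (simp add: double_fact_1)
next
  case (Suc m)
  have "double_fact (2 * Suc m + 1) \<le> (2 * m + 3) * (2 * m + 3) ^ m"
    unfolding double_fact_odd_step using Suc.IH by (rule mult_left_mono) simp
  also have "\<dots> = (2 * m + 3) ^ Suc m" by simp
  also have "\<dots> \<le> (2 * Suc m + 3) ^ Suc m" by (rule power_mono) simp_all
  finally show ?case .
qed

text \<open>The quotient of \<open>double_fact (2 * m + 1) ^ 2\<close> by
  \<open>(m + 1) * double_fact (2 * m) ^ 2\<close> grows with m, as 4(m + 1)(m + 2) \<le> (2m +
  3)^2, and equals 9/8 at m = 1. The excess over 1 later makes room for
  \<open>n ^ Suc n\<close>.\<close>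

lemma wallis_odd_even:
  assumes "m \<ge> 1"
  shows "9 * (m + 1) * double_fact (2 * m) ^ 2 \<le> 8 * double_fact (2 * m + 1) ^ 2"
  using assms
proof (induction m rule: dec_induct)
  case base
  then show ?case by (simp add: double_fact_2 double_fact_3)
next
  case (step m)
  let ?E = "double_fact (2 * m)" and ?O = "double_fact (2 * m + 1)"
  \<comment> \<open>The extra factor \<open>m + 1\<close> avoids division and is cancelled at the
    end.\<close>
  have "(m + 1) * (9 * (Suc m + 1) * ((2 * m + 2) * ?E) ^ 2)
      = (9 * (m + 1) * ?E ^ 2) * (4 * (m + 1) * (m + 2) * (m + 1))"
    by (simp add: algebra_simps power2_eq_square)
  also have "\<dots> \<le> (8 * ?O ^ 2) * ((2 * m + 3) ^ 2 * (m + 1))"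
    by (intro mult_mono step.IH) (simp_all add: algebra_simps power2_eq_square)
  also have "\<dots> = (m + 1) * (8 * ((2 * m + 3) * ?O) ^ 2)"
    by (simp add: algebra_simps power2_eq_square)
  finally show ?case
    unfolding double_fact_even_step double_fact_odd_step by (simp only: mult_le_cancel1)
qed

text \<open>The quotient of the right side by the left grows with m, since (2m + 3)(2m + 5) \<le>
  (2m + 4)^2.\<close>

lemma wallis_even_odd:
  "(2 * m + 3) * double_fact (2 * m + 1) ^ 2 \<le> double_fact (2 * m + 2) ^ 2"
proof (induction m)
  case 0
  then show ?case by (simp add: double_fact_0 double_fact_1 double_fact_Suc_Suc power2_eq_square)
next
  case (Suc m)
  let ?E = "double_fact (2 * m + 2)" and ?O = "double_fact (2 * m + 1)"
  have "(2 * Suc m + 3) * ((2 * m + 3) * ?O) ^ 2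
      = ((2 * m + 5) * (2 * m + 3)) * ((2 * m + 3) * ?O ^ 2)"
    by (simp add: algebra_simps power2_eq_square)
  also have "\<dots> \<le> (2 * m + 4) ^ 2 * ?E ^ 2"
    by (intro mult_mono Suc.IH) (simp_all add: algebra_simps power2_eq_square)
  also have "\<dots> = ((2 * m + 4) * ?E) ^ 2" by (simp add: power_mult_distrib)
  finally show ?case unfolding double_fact_odd_step double_fact_even_step' .
qed

text \<open>The factor 2 pays for the second summand \<open>n ^ Suc n\<close> when n is odd.\<close>

lemma double_le_double_fact_even_odd: "2 * double_fact (2 * m + 1) \<le> double_fact (2 * m + 2)"
proof (induction m)
  case 0
  then show ?case by (simp add: double_fact_0 double_fact_1 double_fact_Suc_Suc)
next
  case (Suc m)
  have "2 * double_fact (2 * Suc m + 1) = (2 * m + 3) * (2 * double_fact (2 * m + 1))"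
    unfolding double_fact_odd_step by simp
  also have "\<dots> \<le> (2 * m + 4) * double_fact (2 * m + 2)"
    by (intro mult_mono Suc.IH) simp_all
  finally show ?case unfolding double_fact_even_step' .
qed

section \<open>The adjacent case k = n + 1\<close>

lemma power_sum_le_double_fact_Suc_odd:
  assumes "n = 2 * m + 1"
  shows "double_fact n ^ Suc n + n ^ Suc n \<le> double_fact (Suc n) ^ n"
proof -
  let ?E = "double_fact (2 * m + 2)" and ?O = "double_fact (2 * m + 1)"
  \<comment> \<open>Of the 2m + 2 copies of \<open>?O\<close>, one is bounded by
    \<open>(2 * m + 3) ^ m\<close>, which the Wallis bound absorbs together with 2m others; the last
    is traded for \<open>?E\<close> with a gain of 2.\<close>
  have "?O ^ Suc (2 * m) \<le> (2 * m + 3) ^ m * (?O ^ 2) ^ m"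
    using double_fact_odd_le[of m] by (simp add: power_mult)
  also have "\<dots> = ((2 * m + 3) * ?O ^ 2) ^ m" by (simp add: power_mult_distrib)
  also have "\<dots> \<le> (?E ^ 2) ^ m"
    by (rule power_mono[OF wallis_even_odd]) simp
  finally have "(2 * ?O) * ?O ^ Suc (2 * m) \<le> ?E * (?E ^ 2) ^ m"
    by (intro mult_mono double_le_double_fact_even_odd) simp_all
  also have "\<dots> = ?E ^ (2 * m + 1)" by (simp flip: power_mult)
  finally have "2 * double_fact n ^ Suc n \<le> double_fact (Suc n) ^ n"
    using assms by (simp add: mult.assoc)
  moreover have "n ^ Suc n \<le> double_fact n ^ Suc n"
    by (rule power_mono[OF le_double_fact]) simp
  ultimately show ?thesis by linarith
qed

text \<open>With E = n!! and O = (n + 1)!!, the Wallis bound gives E^(n+1) \<le> (8/9)^m O^n \<le>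
  (8/9) O^n, while n^(n+1) \<le> E^(n+1)/8; the sum is at most (9/8) E^(n+1) \<le> O^n.\<close>

lemma power_sum_le_double_fact_Suc_even:
  assumes "n = 2 * m" "m \<ge> 2"
  shows "double_fact n ^ Suc n + n ^ Suc n \<le> double_fact (Suc n) ^ n"
proof -
  let ?E = "double_fact n" and ?O = "double_fact (Suc n)"
  have "9 ^ m * ?E ^ Suc n = 9 ^ m * ?E * (?E ^ 2) ^ m"
    using assms by (simp add: power_mult)
  also have "\<dots> \<le> 9 ^ m * (m + 1) ^ m * (?E ^ 2) ^ m"
    using assms double_fact_even_le[of m] by (intro mult_mono) simp_all
  also have "\<dots> = (9 * (m + 1) * ?E ^ 2) ^ m" by (simp only: power_mult_distrib)
  also have "\<dots> \<le> (8 * ?O ^ 2) ^ m"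
    using wallis_odd_even[of m] assms by (intro power_mono) simp_all
  also have "\<dots> = 8 ^ m * ?O ^ n" using assms by (simp add: power_mult_distrib power_mult)
  finally have main: "9 ^ m * ?E ^ Suc n \<le> 8 ^ m * ?O ^ n" .
  obtain l where l: "m = Suc l" using assms(2) by (cases m) auto
  have "9 * (8::nat) ^ m \<le> 8 * 9 ^ m"
    using power_mono[of "8::nat" 9 l] by (simp add: l)
  then have "(9 * 8 ^ m) * ?E ^ Suc n \<le> (8 * 9 ^ m) * ?E ^ Suc n" by (rule mult_right_mono) simp
  also have "\<dots> \<le> 8 ^ m * (8 * ?O ^ n)" using main by simp
  finally have a: "9 * ?E ^ Suc n \<le> 8 * ?O ^ n" by simp
  have "8 * n ^ Suc n \<le> 2 ^ Suc n * n ^ Suc n"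
    using power_increasing[of 3 "Suc n" "2::nat"] assms by (intro mult_right_mono) simp_all
  also have "\<dots> = (2 * n) ^ Suc n" by (simp only: power_mult_distrib)
  also have "\<dots> \<le> ?E ^ Suc n"
    using double_le_double_fact_even[of m] assms by (intro power_mono) simp_all
  finally show ?thesis using a by linarith
qed

lemma power_sum_le_double_fact_Suc:
  assumes "n > 0" "n \<noteq> 2"
  shows "double_fact n ^ Suc n + n ^ Suc n \<le> double_fact (Suc n) ^ n"
proof (cases "even n")
  case True
  then obtain m where "n = 2 * m" by blast
  then show ?thesis using assms by (intro power_sum_le_double_fact_Suc_even[of n m]) simp_all
next
  case False
  then obtain m where "n = 2 * m + 1" by (rule oddE)
  then show ?thesis by (rule power_sum_le_double_fact_Suc_odd)
qed

section \<open>From k = n + 1 to all k > n\<close>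

lemma double_fact_power_Suc_le:
  assumes "k > 0"
  shows "double_fact k ^ Suc k \<le> double_fact (Suc k) ^ k"
proof (cases "k = 2")
  \<comment> \<open>The exceptional \<open>k = 2\<close> still satisfies this weaker bound: 8 \<le>
    9.\<close>
  case True
  then show ?thesis by (simp add: double_fact_2 double_fact_3)
next
  case False
  then show ?thesis using power_sum_le_double_fact_Suc[OF assms] by linarith
qed

text \<open>With M the maximum of a and b, one factor M comes out of each summand on the left, and
  M^k \<le> a^k + b^k.\<close>

lemma power_sum_norm_antimono:
  fixes a b :: nat
  shows "(a ^ Suc k + b ^ Suc k) ^ k \<le> (a ^ k + b ^ k) ^ Suc k"
proof -
  let ?M = "max a b"
  have "a ^ Suc k + b ^ Suc k \<le> ?M * (a ^ k + b ^ k)"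
    unfolding power_Suc distrib_left by (intro add_mono mult_right_mono) simp_all
  then have "(a ^ Suc k + b ^ Suc k) ^ k \<le> (?M * (a ^ k + b ^ k)) ^ k"
    by (rule power_mono) simp
  also have "\<dots> = ?M ^ k * (a ^ k + b ^ k) ^ k" by (simp add: power_mult_distrib)
  also have "\<dots> \<le> (a ^ k + b ^ k) * (a ^ k + b ^ k) ^ k"
    by (rule mult_right_mono) (simp_all add: max_def)
  finally show ?thesis by simp
qed

text \<open>The starting point \<open>j\<close> is left free because n = 2 has to start at 4 instead
  of n + 1.\<close>

lemma power_sum_le_double_fact_mono:
  assumes "j > 0" "j \<le> k" "double_fact n ^ j + n ^ j \<le> double_fact j ^ n"
  shows "double_fact n ^ k + n ^ k \<le> double_fact k ^ n"
  using assms(2)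
proof (induction k rule: dec_induct)
  case base
  then show ?case by (rule assms(3))
next
  case (step k)
  then have k: "k > 0" using assms(1) by simp
  have "(double_fact n ^ Suc k + n ^ Suc k) ^ k \<le> (double_fact n ^ k + n ^ k) ^ Suc k"
    by (rule power_sum_norm_antimono)
  also have "\<dots> \<le> (double_fact k ^ n) ^ Suc k" by (rule power_mono[OF step.IH]) simp
  also have "\<dots> = (double_fact k ^ Suc k) ^ n" by (simp only: power_mult[symmetric] mult.commute)
  also have "\<dots> \<le> (double_fact (Suc k) ^ k) ^ n"
    by (rule power_mono[OF double_fact_power_Suc_le[OF k]]) simp
  also have "\<dots> = (double_fact (Suc k) ^ n) ^ k" by (simp only: power_mult[symmetric] mult.commute)
  \<comment> \<open>Both ends are k-th powers, so a k-th root is taken.\<close>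
  finally show ?case using k by (simp only: power_mono_iff)
qed

lemma double_fact_power_sum_less:
  assumes "n > 0" "n < k"
  shows "double_fact n ^ k + n ^ k < double_fact k ^ n + k ^ n"
proof (cases "n = 2 \<and> k = 3")
  case True
  \<comment> \<open>Here the claim reads 8 + 8 < 9 + 9.\<close>
  then show ?thesis by (simp add: double_fact_2 double_fact_3)
next
  case False
  have "double_fact n ^ k + n ^ k \<le> double_fact k ^ n"
  proof (cases "n = 2")
    case True
    \<comment> \<open>The chain for n = 2 starts from 16 + 16 \<le> 64 at exponent 4.\<close>
    then have "4 \<le> k" using \<open>\<not> (n = 2 \<and> k = 3)\<close> assms by linarith
    then show ?thesis
      by (rule power_sum_le_double_fact_mono[rotated]) (simp_all add: True double_fact_2 double_fact_4)
  next
    case False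
    show ?thesis
      by (rule power_sum_le_double_fact_mono[OF _ _ power_sum_le_double_fact_Suc[OF assms(1) False]])
        (use assms in simp_all)
  qed
  \<comment> \<open>The summand \<open>k ^ n\<close> supplies the strictness.\<close>
  moreover have "k ^ n > 0" using assms by simp
  ultimately show ?thesis by linarith
qed

theorem theorem1p2:
  fixes n k :: nat
  assumes "n > 0" and "k > 0"
  shows "double_fact n ^ k + n ^ k = double_fact k ^ n + k ^ n \<longleftrightarrow> k = n"
  \<comment> \<open>The equation is symmetric in n and k, so the strict inequality refutes both
    orders.\<close>
  using double_fact_power_sum_less[of n k] double_fact_power_sum_less[of k n] assms
  by (cases n k rule: linorder_cases) auto

end
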